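(* Fix $\lambda>0$ and $z>0$. The process $\xi^{\lambda,z}$ is not a Feller process: its semigroup $(P_t)_{t\geq 0}$ does not send $C_0(\mathbb{R})$ into itself.
   Context: Let $B=(B_t)_{t\ge 0}$ be a standard Brownian motion started at $0$. For $\lambda>0$, $z>0$, put $B^\lambda_t=B_t+\lambda t$, $\sigma_z^\lambda=\sup\{t>0: B^\lambda_t=z\}$ (almost surely finite), and $\xi^{\lambda,z}_t=B^\lambda_{t\wedge\sigma_z^\lambda}$, $t\ge 0$. This process is a time-homogeneous Markov process (in its natural filtration) whose semigroup is, for $t>0$ and bounded measurable $f$, $$P_tf(z)=f(z),$$ $$P_tf(x)=f(z)\Big[\Phi\Big(\lambda\sqrt{t}-\tfrac{|z-x|}{\sqrt{t}}\Big)-e^{2\lambda|z-x|}\Phi\Big(-\lambda\sqrt{t}-\tfrac{|z-x|}{\sqrt{t}}\Big)\Big]+e^{\lambda\alpha(z,x)}\int_{\mathbb{R}}f(y)e^{-\lambda\alpha(z,y)}p(t,y-x,\lambda t)\,\mathrm{d}y\quad(x\ne z),$$ where $\Phi$ is the standard normal distribution function, $\alpha(z,x)=|z-x|-(z-x)$, and $p(t,x,y)=\frac{1}{\sqrt{2\pi t}}\exp\big(-\frac{(x-y)^2}{2t}\big)$. $C_0(\mathbb{R})$ is the space of continuous functions vanishing at infinity. A Feller process is a Markov process whose semigroup maps $C_0$ into itself and satisfies $P_tf(x)\to f(x)$ as $t\to0$ for all $f\in C_0$ and all $x$. *)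

theory Defs
  imports "HOL-Probability.Probability"
begin

text \<open>Processes are indexed by \<^typ>\<open>real\<close>; only times \<open>t \<ge> 0\<close> are relevant.\<close>

locale standard_brownian_motion = prob_space M
  for M :: "'a measure" and B :: "real \<Rightarrow> 'a \<Rightarrow> real" +
  assumes measurable_B: "0 \<le> t \<Longrightarrow> B t \<in> borel_measurable M"
    and start_zero: "\<omega> \<in> space M \<Longrightarrow> B 0 \<omega> = 0"
    and continuous_paths: "\<omega> \<in> space M \<Longrightarrow> continuous_on {0..} (\<lambda>t. B t \<omega>)"
    and gaussian_increments:
      "0 \<le> s \<Longrightarrow> s < t \<Longrightarrow>
        distributed M lborel (\<lambda>\<omega>. B t \<omega> - B s \<omega>) (normal_density 0 (sqrt (t - s)))"
    and indep_increments:
      "mono r \<Longrightarrow> 0 \<le> r 0 \<Longrightarrow>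
        indep_vars (\<lambda>_. borel) (\<lambda>i \<omega>. B (r (Suc i)) \<omega> - B (r i) \<omega>) {..<n::nat}"

definition drifted :: "(real \<Rightarrow> 'a \<Rightarrow> real) \<Rightarrow> real \<Rightarrow> real \<Rightarrow> 'a \<Rightarrow> real" where
  "drifted B l t \<omega> = B t \<omega> + l * t"

definition last_passage :: "(real \<Rightarrow> 'a \<Rightarrow> real) \<Rightarrow> real \<Rightarrow> real \<Rightarrow> 'a \<Rightarrow> ereal" where
  "last_passage B l z \<omega> = Sup (ereal ` {t. 0 < t \<and> drifted B l t \<omega> = z})"

text \<open>On the null event that \<open>z\<close> is never hit the supremum is \<open>-\<infinity>\<close>, which
  \<^const>\<open>real_of_ereal\<close> sends to 0, as under the convention \<open>Sup {} = 0\<close> in \<open>[0,\<infinity>]\<close>.\<close>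

definition stopped_process :: "(real \<Rightarrow> 'a \<Rightarrow> real) \<Rightarrow> real \<Rightarrow> real \<Rightarrow> real \<Rightarrow> 'a \<Rightarrow> real" where
  "stopped_process B l z t \<omega> =
     drifted B l (real_of_ereal (min (ereal t) (last_passage B l z \<omega>))) \<omega>"

text \<open>A semigroup is given by its action on bounded Borel functions; its values at negative
  times or on other functions are irrelevant.\<close>

type_synonym operators = "real \<Rightarrow> (real \<Rightarrow> real) \<Rightarrow> real \<Rightarrow> real"

definition bounded_borel :: "(real \<Rightarrow> real) set" where
  "bounded_borel = {f. f \<in> borel_measurable borel \<and> bounded (range f)}"

definition transition_function :: "(real \<Rightarrow> real \<Rightarrow> real measure) \<Rightarrow> bool" where
  "transition_function K \<longleftrightarrow>
     (\<forall>t\<ge>0. K t \<in> borel \<rightarrow>\<^sub>M prob_algebra borel) \<and>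
     (\<forall>x. K 0 x = return borel x) \<and>
     (\<forall>s\<ge>0. \<forall>t\<ge>0. \<forall>x. K (s + t) x = K s x \<bind> K t)"

definition transition_semigroup :: "operators \<Rightarrow> bool" where
  "transition_semigroup Q \<longleftrightarrow>
     (\<exists>K. transition_function K \<and>
       (\<forall>t\<ge>0. \<forall>f\<in>bounded_borel. \<forall>x. Q t f x = (\<integral>y. f y \<partial>K t x)))"

definition natural_filtration ::
  "'a measure \<Rightarrow> (real \<Rightarrow> 'a \<Rightarrow> real) \<Rightarrow> real \<Rightarrow> 'a measure" where
  "natural_filtration M X s =
     sigma (space M) {X u -` A \<inter> space M | u A. 0 \<le> u \<and> u \<le> s \<and> A \<in> sets borel}"

definition markov_with_semigroup ::
  "'a measure \<Rightarrow> (real \<Rightarrow> 'a \<Rightarrow> real) \<Rightarrow> operators \<Rightarrow> bool" where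
  "markov_with_semigroup M X Q \<longleftrightarrow>
     prob_space M \<and> (\<forall>t\<ge>0. X t \<in> borel_measurable M) \<and> transition_semigroup Q \<and>
     (\<forall>s\<ge>0. \<forall>t\<ge>0. \<forall>f\<in>bounded_borel.
        AE \<omega> in M. real_cond_exp M (natural_filtration M X s) (\<lambda>\<omega>. f (X (s + t) \<omega>)) \<omega>
                   = Q t f (X s \<omega>))"

definition C0 :: "(real \<Rightarrow> real) set" where
  "C0 = {f. continuous_on UNIV f \<and> (f \<longlongrightarrow> 0) at_infinity}"

definition preserves_C0 :: "operators \<Rightarrow> bool" where
  "preserves_C0 Q \<longleftrightarrow> (\<forall>t\<ge>0. \<forall>f\<in>C0. Q t f \<in> C0)"

definition feller_process :: "'a measure \<Rightarrow> (real \<Rightarrow> 'a \<Rightarrow> real) \<Rightarrow> bool" where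
  "feller_process M X \<longleftrightarrow>
     (\<exists>Q. markov_with_semigroup M X Q \<and> preserves_C0 Q \<and>
        (\<forall>f\<in>C0. \<forall>x. ((\<lambda>t. Q t f x) \<longlongrightarrow> f x) (at_right 0)))"

definition std_normal_cdf :: "real \<Rightarrow> real" where
  "std_normal_cdf x = cdf (density lborel std_normal_density) x"

definition gauss_kernel :: "real \<Rightarrow> real \<Rightarrow> real \<Rightarrow> real" where
  "gauss_kernel t x y = 1 / sqrt (2 * pi * t) * exp (- ((x - y)\<^sup>2 / (2 * t)))"

definition alpha :: "real \<Rightarrow> real \<Rightarrow> real" where
  "alpha z x = \<bar>z - x\<bar> - (z - x)"

text \<open>The formula holds for \<open>t > 0\<close>; \<open>P\<^sub>0\<close> is the identity.\<close>

definition stopped_semigroup :: "real \<Rightarrow> real \<Rightarrow> operators" where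
  "stopped_semigroup l z t f x =
     (if t = 0 then f x
      else if x = z then f z
      else f z * (std_normal_cdf (l * sqrt t - \<bar>z - x\<bar> / sqrt t)
                  - exp (2 * l * \<bar>z - x\<bar>) * std_normal_cdf (- l * sqrt t - \<bar>z - x\<bar> / sqrt t))
           + exp (l * alpha z x) *
             (\<integral>y. f y * exp (- l * alpha z y) * gauss_kernel t (y - x) (l * t) \<partial>lborel))"

end

theory Submission
  imports Defs
begin

text \<open>
  Let \<open>W\<close> be the drifted motion and \<open>X\<close> the stopped process. Since \<open>W\<close> tends to infinity, \<open>X\<close> sits
  at \<open>z\<close> with positive probability from some time \<open>s\<close> on, and up to a null set it never leaves \<open>z\<close>
  afterwards; hence \<open>Q\<^sub>1 f z = f z\<close> for every semigroup \<open>Q\<close> of \<open>X\<close>. For a bump \<open>f\<close> with \<open>f z = 0\<close>,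
  continuity of \<open>Q\<^sub>1 f\<close> would make \<open>Q\<^sub>1 f\<close> small near \<open>z\<close>. But if \<open>W\<close> is near, and not at, \<open>z\<close> at time \<open>s\<close>,
  then an independent increment in \<open>(-2, -1)\<close> over \<open>[s, s + 1]\<close> moves it below \<open>z\<close>; as it must return
  to \<open>z\<close> later, it has not been stopped yet, so \<open>f (X (s + 1)) \<ge> 1\<close> with a conditional
  probability that is bounded below, however small the neighbourhood of \<open>z\<close>.

  That \<open>W\<close> tends to infinity follows from fourth moments: dyadic chaining bounds the oscillation of
  \<open>B\<close> on \<open>[n, n + 1]\<close> by a small multiple of \<open>n\<close> outside an event of summable probability.
\<close>

section \<open>Growth of Brownian paths: chaining, fourth moments, Borel-Cantelli\<close>

text \<open>A dyadic point of level \<open>k + 1\<close> either has level \<open>k\<close> already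
  or lies one step of length \<open>1 / 2 ^ (k + 1)\<close> to the right of such a point. So
  reaching it from 0 costs at most one step per level, and the steps add up to a geometric series.
  Continuity carries the bound from dyadic points to all of the unit interval.\<close>

lemma dyadic_chaining:
  fixes g :: "real \<Rightarrow> real"
  assumes cont: "continuous_on {0..1} g"
    and r: "0 \<le> r" "r < 1" and "0 \<le> a"
    and step: "\<And>k j. j < 2 ^ k \<Longrightarrow> \<bar>g (real (Suc j) / 2 ^ k) - g (real j / 2 ^ k)\<bar> \<le> a * r ^ k"
    and x: "0 \<le> x" "x \<le> 1"
  shows "\<bar>g x - g 0\<bar> \<le> a / (1 - r)"
proof -
  have grid_sum: "\<bar>g (real j / 2 ^ k) - g 0\<bar> \<le> a * (\<Sum>i\<le>k. r ^ i)" if "j \<le> 2 ^ k" for j k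
    using that
  proof (induction k arbitrary: j)
    case 0
    then consider "j = 0" | "j = 1" by force
    then show ?case using step[of 0 0] \<open>0 \<le> a\<close> by cases auto
  next
    case (Suc k)
    have double: "real (2 * i) / 2 ^ Suc k = real i / 2 ^ k" for i by simp
    show ?case
    proof (cases "even j")
      case True
      then obtain i where i: "j = 2 * i" by blast
      have "\<bar>g (real j / 2 ^ Suc k) - g 0\<bar> \<le> a * (\<Sum>i\<le>k. r ^ i)"
        unfolding i double using Suc i by auto
      also have "\<dots> \<le> a * (\<Sum>i\<le>Suc k. r ^ i)"
        using \<open>0 \<le> a\<close> r by (intro mult_left_mono) auto
      finally show ?thesis .
    next
      case False
      then obtain i where i: "j = Suc (2 * i)" by (auto elim: oddE)
      have "\<bar>g (real (2 * i) / 2 ^ Suc k) - g 0\<bar> \<le> a * (\<Sum>i\<le>k. r ^ i)"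
        unfolding double using Suc i by auto
      moreover have "\<bar>g (real j / 2 ^ Suc k) - g (real (2 * i) / 2 ^ Suc k)\<bar> \<le> a * r ^ Suc k"
        unfolding i using Suc.prems i by (intro step) auto
      ultimately show ?thesis by (simp add: distrib_left)
    qed
  qed
  have grid: "\<bar>g (real j / 2 ^ k) - g 0\<bar> \<le> a / (1 - r)" if "j \<le> 2 ^ k" for j k
  proof -
    have "(\<Sum>i\<le>k. r ^ i) \<le> (\<Sum>i. r ^ i)"
      using r by (intro sum_le_suminf summable_geometric) auto
    also have "\<dots> = 1 / (1 - r)" using r by (intro suminf_geometric) auto
    finally have "a * (\<Sum>i\<le>k. r ^ i) \<le> a * (1 / (1 - r))"
      using \<open>0 \<le> a\<close> by (rule mult_left_mono)
    with grid_sum[OF that] show ?thesis by simp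
  qed
  \<comment> \<open>\<open>u k\<close> is the largest point of the level-\<open>k\<close> grid not
    exceeding \<open>x\<close>, hence within \<open>(1 / 2) ^ k\<close> of it.\<close>
  define u where "u k = real (nat \<lfloor>2 ^ k * x\<rfloor>) / 2 ^ k" for k :: nat
  have j_le: "nat \<lfloor>2 ^ k * x\<rfloor> \<le> 2 ^ k" for k
  proof -
    have "2 ^ k * x \<le> 2 ^ k" using x by simp
    then have "\<lfloor>2 ^ k * x\<rfloor> \<le> 2 ^ k" 
      using floor_mono[of "2 ^ k * x" "of_int (2 ^ k)"] by (simp only: floor_of_int) simp
    then show ?thesis by (simp add: nat_le_iff)
  qed
  have u_eq: "u k = of_int \<lfloor>2 ^ k * x\<rfloor> / 2 ^ k" for k
    using x by (simp add: u_def)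
  have u_le: "u k \<le> x" for k
    by (simp add: u_eq divide_le_eq mult.commute)
  have u_ge: "x - (1 / 2) ^ k \<le> u k" for k
  proof -
    have "2 ^ k * x - 1 \<le> of_int \<lfloor>2 ^ k * x\<rfloor>" by linarith
    then have "(2 ^ k * x - 1) / 2 ^ k \<le> u k" unfolding u_eq by (intro divide_right_mono) auto
    then show ?thesis by (simp add: diff_divide_distrib power_one_over)
  qed
  have "(\<lambda>k. x - (1 / 2) ^ k) \<longlonglongrightarrow> x - 0"
    by (intro tendsto_intros LIMSEQ_power_zero) auto
  then have "u \<longlonglongrightarrow> x"
    using u_ge u_le by (intro real_tendsto_sandwich[of "\<lambda>k. x - (1 / 2) ^ k" u _ "\<lambda>_. x"]) auto
  moreover have "u k \<in> {0..1}" for k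
  proof -
    have "0 \<le> u k" by (simp add: u_def)
    with u_le[of k] x show ?thesis by simp
  qed
  ultimately have "(\<lambda>k. g (u k)) \<longlonglongrightarrow> g x"
    using x by (intro continuous_on_tendsto_compose[OF cont]) auto
  then have "(\<lambda>k. \<bar>g (u k) - g 0\<bar>) \<longlonglongrightarrow> \<bar>g x - g 0\<bar>"
    by (intro tendsto_intros)
  moreover have "\<bar>g (u k) - g 0\<bar> \<le> a / (1 - r)" for k
    unfolding u_def using j_le by (rule grid)
  ultimately show ?thesis
    by (intro LIMSEQ_le_const2) auto
qed

context standard_brownian_motion
begin

text \<open>Markov's inequality for the fourth power, whose mean is three times the squared
  variance. The second moment would be too weak for chaining: over \<open>2 ^ k\<close> steps of
  length \<open>1 / 2 ^ k\<close> its bounds do not decay in \<open>k\<close>.\<close>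

lemma increment_tail:
  assumes "0 \<le> s" "s < t" "0 < a"
  shows "prob {\<omega> \<in> space M. \<bar>B t \<omega> - B s \<omega>\<bar> \<ge> a} \<le> 3 * (t - s)\<^sup>2 / a ^ 4"
proof -
  let ?D = "normal_density 0 (sqrt (t - s))"
  have D: "distributed M lborel (\<lambda>\<omega>. B t \<omega> - B s \<omega>) ?D"
    using assms by (intro gaussian_increments)
  have m: "has_bochner_integral lborel (\<lambda>x. ?D x * x ^ 4) (3 * (t - s)\<^sup>2)"
  proof -
    have "fact (2 * 2) / ((2 / (sqrt (t - s))\<^sup>2)\<^sup>2 * fact 2) = 3 * (t - s)\<^sup>2"
      using assms by (simp add: fact_numeral power_divide)
    with normal_moment_even[where \<mu> = 0 and \<sigma> = "sqrt (t - s)" and k = 2] assms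
    have "has_bochner_integral lborel (\<lambda>x. ?D x * (x - 0) ^ (2 * 2)) (3 * (t - s)\<^sup>2)"
      by simp
    then show ?thesis by simp
  qed
  have int: "integrable M (\<lambda>\<omega>. (B t \<omega> - B s \<omega>) ^ 4)"
    using distributed_integrable[OF D, of "\<lambda>x. x ^ 4"] m by (simp add: has_bochner_integral_iff)
  have val: "(\<integral>\<omega>. (B t \<omega> - B s \<omega>) ^ 4 \<partial>M) = 3 * (t - s)\<^sup>2"
    using distributed_integral[OF D, of "\<lambda>x. x ^ 4"] m by (simp add: has_bochner_integral_iff)
  have "a \<le> \<bar>x\<bar> \<longleftrightarrow> a ^ 4 \<le> x ^ 4" for x :: real
    using power_mono_iff[of a "\<bar>x\<bar>" 4] \<open>0 < a\<close> by (simp add: power_even_abs)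
  then have "prob {\<omega> \<in> space M. \<bar>B t \<omega> - B s \<omega>\<bar> \<ge> a}
      = prob {\<omega> \<in> space M. (B t \<omega> - B s \<omega>) ^ 4 \<ge> a ^ 4}" by simp
  also have "\<dots> \<le> 3 * (t - s)\<^sup>2 / a ^ 4"
    using integral_Markov_inequality_measure[OF int, of "space M" "a ^ 4"] assms val by simp
  finally show ?thesis .
qed

text \<open>Outside this union \<open>dyadic_chaining\<close> with ratio \<open>9 / 10\<close> keeps
  the path on \<open>[s, s + 1]\<close> within \<open>10 * a\<close> of \<open>B s\<close>. A union
  bound with \<open>increment_tail\<close> gives a convergent geometric series over the levels,
  because \<open>(9 / 10) ^ 4\<close> exceeds \<open>1 / 2\<close>.\<close>

lemma chaining_event_bound:
  assumes "0 \<le> s" "0 < a"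
  defines "E \<equiv> \<lambda>k. \<Union>j<2 ^ k. {\<omega> \<in> space M.
      \<bar>B (s + real (Suc j) / 2 ^ k) \<omega> - B (s + real j / 2 ^ k) \<omega>\<bar> \<ge> a * (9 / 10) ^ k}"
  shows "(\<Union>k. E k) \<in> events" and "prob (\<Union>k. E k) \<le> 15 / a ^ 4"
proof -
  have step_ev: "{\<omega> \<in> space M.
      \<bar>B (s + real (Suc j) / 2 ^ k) \<omega> - B (s + real j / 2 ^ k) \<omega>\<bar> \<ge> c} \<in> events" for j k c
  proof -
    have [measurable]: "B (s + real (Suc j) / 2 ^ k) \<in> borel_measurable M"
      "B (s + real j / 2 ^ k) \<in> borel_measurable M"
      using \<open>0 \<le> s\<close> by (auto intro!: measurable_B)
    show ?thesis by measurable
  qed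
  then have ev: "E k \<in> events" for k unfolding E_def by auto
  then show "(\<Union>k. E k) \<in> events" by auto
  \<comment> \<open>The ratio 5000/6561 is 2 * (1/2)^2 / (9/10)^4.\<close>
  have bound: "prob (E k) \<le> 3 / a ^ 4 * (5000 / 6561) ^ k" for k
  proof -
    have "prob (E k) \<le> (\<Sum>j<2 ^ k. prob {\<omega> \<in> space M.
      \<bar>B (s + real (Suc j) / 2 ^ k) \<omega> - B (s + real j / 2 ^ k) \<omega>\<bar> \<ge> a * (9 / 10) ^ k})"
      unfolding E_def using step_ev by (intro finite_measure_subadditive_finite) auto
    also have "\<dots> \<le> (\<Sum>j<(2::nat) ^ k. 3 * (1 / 2 ^ k)\<^sup>2 / (a * (9 / 10) ^ k) ^ 4)"
    proof (intro sum_mono)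
      fix j :: nat
      have d: "s + real (Suc j) / 2 ^ k - (s + real j / 2 ^ k) = 1 / 2 ^ k"
        by (simp add: field_simps)
      show "prob {\<omega> \<in> space M.
        \<bar>B (s + real (Suc j) / 2 ^ k) \<omega> - B (s + real j / 2 ^ k) \<omega>\<bar> \<ge> a * (9 / 10) ^ k}
        \<le> 3 * (1 / 2 ^ k)\<^sup>2 / (a * (9 / 10) ^ k) ^ 4"
        using increment_tail[of "s + real j / 2 ^ k" "s + real (Suc j) / 2 ^ k" "a * (9 / 10) ^ k"]
          assms(1,2) unfolding d by (auto simp: divide_strict_right_mono)
    qed
    also have "\<dots> = 3 / a ^ 4 * (2 ^ k * ((1 / 2 ^ k)\<^sup>2 / ((9 / 10) ^ k) ^ 4))"
      by (simp add: power_mult_distrib)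
    also have "2 ^ k * ((1 / 2 ^ k)\<^sup>2 / ((9 / 10) ^ k) ^ 4) = (2 * ((1 / 2)\<^sup>2 / (9 / 10) ^ 4) :: real) ^ k"
    proof -
      have swap: "(c ^ m) ^ i = (c ^ i) ^ m" for c :: real and m i :: nat
        by (simp add: mult.commute flip: power_mult)
      show ?thesis
        by (simp only: power_mult_distrib power_divide swap[of _ k 2] swap[of _ k 4] power_one)
    qed
    also have "(2 * ((1 / 2)\<^sup>2 / (9 / 10) ^ 4)) = (5000 / 6561 :: real)"
      by (simp add: power_divide)
    finally show ?thesis .
  qed
  have geo: "(\<lambda>k. 3 / a ^ 4 * (5000 / 6561) ^ k) sums (3 / a ^ 4 * (1 / (1 - 5000 / 6561)))"
    by (intro sums_mult geometric_sums) auto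
  have summ: "summable (\<lambda>k. prob (E k))"
    by (rule summable_comparison_test'[OF sums_summable[OF geo], of 0]) (use bound in auto)
  have "prob (\<Union>k. E k) \<le> (\<Sum>k. prob (E k))"
    using ev summ by (intro finite_measure_subadditive_countably) auto
  also have "\<dots> \<le> 3 / a ^ 4 * (1 / (1 - 5000 / 6561))"
    using suminf_le[OF bound summ sums_summable[OF geo]] sums_unique[OF geo] by simp
  \<comment> \<open>The exact constant is about 12.6.\<close>
  also have "\<dots> \<le> 15 / a ^ 4"
    using \<open>0 < a\<close> by (simp add: field_simps)
  finally show "prob (\<Union>k. E k) \<le> 15 / a ^ 4" .
qed

text \<open>Borel-Cantelli is applied to two events: a large oscillation of \<open>B\<close> on
  \<open>[n + 1, n + 2]\<close>, and a large value of \<open>B\<close> at \<open>n + 1\<close>. With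
  thresholds linear in \<open>n\<close> both have summable probabilities, and outside them the drift
  wins.\<close>

lemma drifted_tendsto_infinity:
  assumes "0 < l"
  shows "AE \<omega> in M. \<forall>c. \<exists>N::nat. \<forall>t\<ge>real N. c < drifted B l t \<omega>"
proof -
  \<comment> \<open>Chaining costs \<open>10 * a n\<close> and the value at \<open>Suc n\<close>
    another \<open>a n\<close>. The factor \<open>1 / 40\<close> makes the total
    \<open>11 / 40\<close> of the drift \<open>l * Suc n\<close>, less than half of it; the
    remainder beats any \<open>c\<close> with \<open>2 * \<bar>c\<bar> < l * Suc n\<close>.\<close>
  define a where "a n = l / 40 * real (Suc n)" for n
  define E where "E n k = (\<Union>j<2 ^ k. {\<omega> \<in> space M.
      \<bar>B (real (Suc n) + real (Suc j) / 2 ^ k) \<omega> - B (real (Suc n) + real j / 2 ^ k) \<omega>\<bar>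
        \<ge> a n * (9 / 10) ^ k})" for n k
  define F where "F n = {\<omega> \<in> space M. \<bar>B (real (Suc n)) \<omega> - B 0 \<omega>\<bar> \<ge> a n}" for n
  have a_pos: "0 < a n" for n using assms by (simp add: a_def)
  have sum2: "summable (\<lambda>n. C * (1 / real (Suc n) ^ 2))" for C
    using inverse_power_summable[of 2, where 'a = real]
    by (intro summable_mult) (subst summable_Suc_iff, simp add: inverse_eq_divide)
  have E_ev: "(\<Union>k. E n k) \<in> events" for n
    unfolding E_def using a_pos by (intro chaining_event_bound) auto
  have "prob (\<Union>k. E n k) \<le> 15 / (l / 40) ^ 4 * (1 / real (Suc n) ^ 2)" for n
  proof -
    have "prob (\<Union>k. E n k) \<le> 15 / a n ^ 4"
      unfolding E_def using a_pos by (intro chaining_event_bound) auto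
    also have "\<dots> = 15 / (l / 40) ^ 4 * (1 / real (Suc n) ^ 4)"
      unfolding a_def power_mult_distrib by simp
    \<comment> \<open>Weakened to exponent 2, so that \<open>sum2\<close> serves for both
      series.\<close>
    also have "\<dots> \<le> 15 / (l / 40) ^ 4 * (1 / real (Suc n) ^ 2)"
      using assms by (intro mult_left_mono divide_left_mono power_increasing) auto
    finally show ?thesis .
  qed
  then have "summable (\<lambda>n. prob (\<Union>k. E n k))"
    by (intro summable_comparison_test'[OF sum2[of "15 / (l / 40) ^ 4"], of 0])
      (simp only: real_norm_def abs_of_nonneg measure_nonneg)
  then have "AE \<omega> in M. eventually (\<lambda>n. \<omega> \<in> space M - (\<Union>k. E n k)) sequentially"
    using E_ev by (intro borel_cantelli_AE1) (auto simp: emeasure_eq_measure)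
  moreover have F_ev: "F n \<in> events" for n
    unfolding F_def using measurable_B[of "real (Suc n)"] measurable_B[of 0] by measurable
  have "prob (F n) \<le> 3 / (l / 40) ^ 4 * (1 / real (Suc n) ^ 2)" for n
  proof -
    have "3 * m\<^sup>2 / (c * m) ^ 4 = 3 / c ^ 4 * (1 / m\<^sup>2)" if "m > 0" for m c :: real
      using that by (simp add: power_mult_distrib power2_eq_square power4_eq_xxxx)
    note this[of "real (Suc n)" "l / 40"]
    then show ?thesis
      using increment_tail[of 0 "real (Suc n)" "a n"] a_pos[of n] unfolding F_def a_def
      by (simp only: diff_zero order_refl of_nat_0_less_iff zero_less_Suc)
  qed
  then have "summable (\<lambda>n. prob (F n))"
    by (intro summable_comparison_test'[OF sum2[of "3 / (l / 40) ^ 4"], of 0])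
      (simp only: real_norm_def abs_of_nonneg measure_nonneg)
  then have "AE \<omega> in M. eventually (\<lambda>n. \<omega> \<in> space M - F n) sequentially"
    using F_ev by (intro borel_cantelli_AE1) (auto simp: emeasure_eq_measure)
  ultimately show ?thesis
  proof (eventually_elim, intro allI)
    fix \<omega> c
    assume "eventually (\<lambda>n. \<omega> \<in> space M - (\<Union>k. E n k)) sequentially"
      "eventually (\<lambda>n. \<omega> \<in> space M - F n) sequentially"
    then have "eventually (\<lambda>n. \<omega> \<in> space M - (\<Union>k. E n k) \<and> \<omega> \<in> space M - F n) sequentially"
      by (rule eventually_conj)
    then obtain N where N: "\<And>n. n \<ge> N \<Longrightarrow> \<omega> \<in> space M \<and> \<omega> \<notin> (\<Union>k. E n k) \<and> \<omega> \<notin> F n"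
      unfolding eventually_sequentially by blast
    obtain K :: nat where K: "2 * \<bar>c\<bar> / l < real K" using reals_Archimedean2 by blast
    have "c < drifted B l t \<omega>" if t: "real (Suc (max N K)) \<le> t" for t
    proof -
      \<comment> \<open>The index is shifted so that \<open>Suc n\<close> is the integer part of
        \<open>t\<close>, and \<open>t\<close> lies in the block controlled by
        \<open>E n\<close>.\<close>
      define n where "n = nat \<lfloor>t\<rfloor> - 1"
      have "1 \<le> t" using t by linarith
      then have Sn: "real (Suc n) = of_int \<lfloor>t\<rfloor>" unfolding n_def by (auto simp: le_nat_iff le_floor_iff)
      have "n \<ge> N" "real (Suc n) \<ge> real K" using t unfolding n_def by linarith+
      have \<omega>: "\<omega> \<in> space M" using N[of N] by simp
      define g where "g x = B (real (Suc n) + x) \<omega>" for x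
      have "\<bar>g (t - real (Suc n)) - g 0\<bar> \<le> a n / (1 - 9 / 10)"
      proof (rule dyadic_chaining)
        show "continuous_on {0..1} g"
          unfolding g_def
          by (rule continuous_on_compose2[OF continuous_paths[OF \<omega>]]) (auto intro!: continuous_intros)
        show "\<bar>g (real (Suc j) / 2 ^ k) - g (real j / 2 ^ k)\<bar> \<le> a n * (9 / 10) ^ k"
          if "j < 2 ^ k" for j k
          using N[OF \<open>n \<ge> N\<close>] that \<omega> unfolding E_def g_def by (force simp: not_le)
      qed (use a_pos[of n] Sn in \<open>auto, linarith+\<close>)
      moreover have "\<bar>B (real (Suc n)) \<omega>\<bar> < a n"
        using N[OF \<open>n \<ge> N\<close>] \<omega> start_zero[OF \<omega>] unfolding F_def by (simp add: not_le)
      ultimately have "B t \<omega> > - 11 * a n"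
        unfolding g_def by simp
      moreover have "11 * a n = 11 / 40 * (l * real (Suc n))" by (simp add: a_def)
      moreover have "l * real (Suc n) \<le> l * t" using Sn assms by (intro mult_left_mono) auto
      moreover have "2 * \<bar>c\<bar> < l * real (Suc n)"
      proof -
        have "2 * \<bar>c\<bar> < l * real K" using K assms by (simp add: field_simps)
        also have "\<dots> \<le> l * real (Suc n)"
          using \<open>real (Suc n) \<ge> real K\<close> assms by (intro mult_left_mono) auto
        finally show ?thesis .
      qed
      ultimately show ?thesis unfolding drifted_def by linarith
    qed
    then show "\<exists>N::nat. \<forall>t\<ge>real N. c < drifted B l t \<omega>" by blast
  qed
qed

end

section \<open>Laws with a density: intervals have positive mass, points have none\<close>

text \<open>A strictly positive density has zero integral only over Lebesgue null sets, and a
  nondegenerate interval is not one.\<close>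

lemma distributed_open_interval_pos:
  fixes f :: "real \<Rightarrow> real"
  assumes "prob_space M" "distributed M lborel X (\<lambda>x. ennreal (f x))" "\<And>x. 0 < f x" "a < b"
  shows "0 < measure M (X -` {a<..<b} \<inter> space M)"
proof -
  interpret prob_space M by fact
  have m[measurable]: "(\<lambda>x. ennreal (f x)) \<in> borel_measurable lborel"
    using assms(2) by (rule distributed_borel_measurable)
  have "emeasure M (X -` {a<..<b} \<inter> space M)
      = (\<integral>\<^sup>+x. ennreal (f x) * indicator {a<..<b} x \<partial>lborel)"
    using assms(2) by (rule distributed_emeasure) auto
  moreover have "\<dots> \<noteq> 0"
  proof
    assume "(\<integral>\<^sup>+x. ennreal (f x) * indicator {a<..<b} x \<partial>lborel) = 0"
    then have "AE x in lborel. ennreal (f x) * indicator {a<..<b} x = 0"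
      by (subst (asm) nn_integral_0_iff_AE) measurable
    then have "AE x in lborel. x \<notin> {a<..<b}"
      by eventually_elim (use assms(3) in \<open>auto split: split_indicator_asm simp: ennreal_eq_0_iff not_le[symmetric]\<close>)
    then have "emeasure lborel {a<..<b} = 0"
      by (subst (asm) AE_iff_measurable[where N = "{a<..<b}"]) auto
    then show False using \<open>a < b\<close> by simp
  qed
  ultimately have "ennreal (prob (X -` {a<..<b} \<inter> space M)) \<noteq> 0"
    by (simp add: emeasure_eq_measure)
  then show ?thesis by (simp add: zero_less_measure_iff)
qed

lemma distributed_AE_neq:
  assumes "distributed M lborel X f"
  shows "AE \<omega> in M. X \<omega> \<noteq> (c::real)"
proof -
  have X: "X \<in> borel_measurable M" using distributed_measurable[OF assms] by simp
  have f[measurable]: "f \<in> borel_measurable lborel"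
    using assms by (rule distributed_borel_measurable)
  have "AE x in lborel. x \<noteq> c" by (rule AE_lborel_singleton)
  then have "(\<integral>\<^sup>+x. f x * indicator {c} x \<partial>lborel) = (\<integral>\<^sup>+x. 0 \<partial>(lborel :: real measure))"
    by (intro nn_integral_cong_AE) (auto elim!: eventually_mono)
  then have "emeasure M (X -` {c} \<inter> space M) = 0"
    using distributed_emeasure[OF assms, of "{c}"] by simp
  then show ?thesis
    using X by (intro AE_I[of _ _ "X -` {c} \<inter> space M"]) auto
qed

section \<open>A test function, and the explicit semigroup\<close>

text \<open>A bump supported on \<open>{z - 3..z}\<close>. It vanishes at \<open>z\<close> but is at
  least 1 on \<open>{z - 5 / 2..z - 1 / 2}\<close>, where a point within \<open>1 / 2\<close> of
  \<open>z\<close> lands after a move in \<open>(-2, -1)\<close>.\<close>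

definition tent :: "real \<Rightarrow> real \<Rightarrow> real" where
  "tent z x = max 0 (3 - 2 * \<bar>x - (z - 3 / 2)\<bar>)"

lemma tent_at [simp]: "tent z z = 0"
  by (simp add: tent_def)

lemma tent_nonneg: "0 \<le> tent z x" and tent_le: "tent z x \<le> 3"
  by (auto simp: tent_def)

lemma tent_ge_1: "z - 5 / 2 \<le> x \<Longrightarrow> x \<le> z - 1 / 2 \<Longrightarrow> 1 \<le> tent z x"
  by (auto simp: tent_def abs_if)

lemma tent_outside: "x \<notin> {z - 3..z} \<Longrightarrow> tent z x = 0"
  by (auto simp: tent_def abs_if)

lemma continuous_on_tent: "continuous_on A (tent z)"
  unfolding tent_def by (intro continuous_intros)

lemma tent_C0: "tent z \<in> C0"
proof -
  have "eventually (\<lambda>x. tent z x = 0) at_infinity"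
    unfolding eventually_at_infinity
    by (rule exI[of _ "\<bar>z\<bar> + 4"]) (auto intro!: tent_outside)
  then show ?thesis
    unfolding C0_def by (auto intro: continuous_on_tent tendsto_eventually)
qed

lemma tent_bounded_borel: "tent z \<in> bounded_borel"
  unfolding bounded_borel_def bounded_iff
  using tent_nonneg tent_le
  by (auto intro!: borel_measurable_continuous_onI continuous_on_tent exI[of _ 3])

text \<open>Applied to the bump, the formula gives 0 at \<open>z\<close>. For other \<open>x\<close>
  the term with the factor \<open>f z\<close> vanishes, but the Gaussian integral stays above a
  positive constant as \<open>x\<close> tends to \<open>z\<close>, so continuity fails at
  \<open>z\<close>.\<close>

lemma stopped_semigroup_not_C0:
  assumes "l > 0"
  shows "\<not> preserves_C0 (stopped_semigroup l z)"
proof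
  assume "preserves_C0 (stopped_semigroup l z)"
  then have "stopped_semigroup l z 1 (tent z) \<in> C0"
    using tent_C0 by (auto simp: preserves_C0_def)
  then have "continuous_on UNIV (stopped_semigroup l z 1 (tent z))" by (simp add: C0_def)
  then have lim: "((stopped_semigroup l z 1 (tent z)) \<longlongrightarrow> 0) (at z)"
    using isCont_def[of z "stopped_semigroup l z 1 (tent z)"]
    by (simp add: continuous_on_eq_continuous_at stopped_semigroup_def[of l z 1 _ z])
  \<comment> \<open>The Gaussian kernel at time 1 and distance \<open>3 + l\<close>. This distance
    bounds \<open>\<bar>y - x - l\<bar>\<close> for \<open>x\<close> within 1 of \<open>z\<close>
    and \<open>y\<close> in \<open>{z - 2..z - 1}\<close>, an interval of length 1 on which the bump
    is at least 1 and the exponential weight equals 1.\<close>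
  define c where "c = 1 / sqrt (2 * pi) * exp (- ((3 + l)\<^sup>2 / 2))"
  have "0 < c" by (simp add: c_def)
  have bound: "c \<le> stopped_semigroup l z 1 (tent z) x" if "x \<noteq> z" "\<bar>x - z\<bar> < 1" for x
  proof -
    define h where "h y = tent z y * exp (- l * alpha z y) * gauss_kernel 1 (y - x) (l * 1)" for y
    have h_nonneg: "0 \<le> h y" for y
      by (simp add: h_def gauss_kernel_def tent_nonneg)
    \<comment> \<open>Integrability comes from the compact support of the bump, which
      \<open>h\<close> inherits.\<close>
    have "integrable lborel (\<lambda>y. indicator {z - 3..z} y *\<^sub>R h y)"
      unfolding h_def alpha_def gauss_kernel_def
      by (intro borel_integrable_compact continuous_intros continuous_on_tent) auto
    moreover have "(\<lambda>y. indicator {z - 3..z} y *\<^sub>R h y) = h"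
      using tent_outside[of _ z] by (auto simp: fun_eq_iff h_def indicator_def)
    ultimately have h_int: "integrable lborel h" by simp
    have "c = (\<integral>y. c * indicator {z - 2..z - 1} y \<partial>lborel)" by simp
    also have "\<dots> \<le> (\<integral>y. h y \<partial>lborel)"
    proof (rule integral_mono[OF _ h_int])
      fix y
      show "c * indicator {z - 2..z - 1} y \<le> h y"
      proof (cases "y \<in> {z - 2..z - 1}")
        case True
        then have "1 \<le> tent z y" "alpha z y = 0" by (auto intro!: tent_ge_1 simp: alpha_def)
        moreover have "c \<le> gauss_kernel 1 (y - x) l"
        proof -
          have "\<bar>y - x - l\<bar> \<le> \<bar>3 + l\<bar>" using True that assms by auto
          then have "(y - x - l)\<^sup>2 \<le> (3 + l)\<^sup>2" by (simp add: abs_le_square_iff)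
          then show ?thesis by (auto simp: c_def gauss_kernel_def intro!: divide_right_mono)
        qed
        ultimately have "1 * c \<le> h y"
          using mult_mono[of 1 "tent z y" c "gauss_kernel 1 (y - x) l"] \<open>0 < c\<close>
          by (simp add: h_def tent_nonneg)
        then show ?thesis using True by simp
      qed (simp add: h_nonneg)
    qed (simp add: integrable_mult_right)
    also have "\<dots> \<le> exp (l * alpha z x) * (\<integral>y. h y \<partial>lborel)"
    proof -
      have "1 \<le> exp (l * alpha z x)" using assms by (simp add: alpha_def)
      moreover have "0 \<le> (\<integral>y. h y \<partial>lborel)" by (intro integral_nonneg_AE) (simp add: h_nonneg)
      ultimately have "1 * (\<integral>y. h y \<partial>lborel) \<le> exp (l * alpha z x) * (\<integral>y. h y \<partial>lborel)"
        by (rule mult_right_mono)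
      then show ?thesis by simp
    qed
    also have "\<dots> = stopped_semigroup l z 1 (tent z) x"
      using that by (simp add: stopped_semigroup_def h_def)
    finally show ?thesis .
  qed
  have "eventually (\<lambda>x. c \<le> stopped_semigroup l z 1 (tent z) x) (at z)"
    unfolding eventually_at using bound by (intro exI[of _ 1]) (auto simp: dist_real_def)
  then have "c \<le> 0" using lim by (intro tendsto_lowerbound[OF lim]) auto
  with \<open>0 < c\<close> show False by simp
qed

section \<open>Paths of the stopped process, and the law of position and increment\<close>

context standard_brownian_motion
begin

lemma continuous_on_drifted:
  "\<omega> \<in> space M \<Longrightarrow> continuous_on {0..} (\<lambda>t. drifted B l t \<omega>)"
  unfolding drifted_def by (intro continuous_intros continuous_paths)

lemma drifted_hits:
  assumes "\<omega> \<in> space M" "0 \<le> a" "a \<le> b" "drifted B l a \<omega> < z" "z < drifted B l b \<omega>"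
  obtains t where "a < t" "t < b" "drifted B l t \<omega> = z"
proof -
  have "continuous_on {a..b} (\<lambda>t. drifted B l t \<omega>)"
    using assms by (intro continuous_on_subset[OF continuous_on_drifted]) auto
  then obtain t where "a \<le> t" "t \<le> b" "drifted B l t \<omega> = z"
    using IVT'[of "\<lambda>t. drifted B l t \<omega>" a z b] assms by auto
  moreover from this have "t \<noteq> a" "t \<noteq> b" using assms by auto
  ultimately show thesis using that[of t] by simp
qed

lemma le_last_passage: "0 < t \<Longrightarrow> drifted B l t \<omega> = z \<Longrightarrow> ereal t \<le> last_passage B l z \<omega>"
  unfolding last_passage_def by (intro Sup_upper) auto

lemma stopped_process_before:
  "ereal t \<le> last_passage B l z \<omega> \<Longrightarrow> stopped_process B l z t \<omega> = drifted B l t \<omega>"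
  by (simp add: stopped_process_def min_def)

lemma stopped_process_after:
  assumes "last_passage B l z \<omega> \<le> ereal s" "s \<le> t"
  shows "stopped_process B l z t \<omega> = stopped_process B l z s \<omega>"
proof -
  have "last_passage B l z \<omega> \<le> ereal t" using assms by (metis ereal_less_eq(3) order_trans)
  with assms show ?thesis by (simp add: stopped_process_def min_absorb2)
qed

text \<open>The hitting times form a closed, nonempty, bounded set, so their supremum is itself a
  hitting time.\<close>

lemma stopped_process_at_level:
  assumes "\<omega> \<in> space M" "z \<noteq> 0" "last_passage B l z \<omega> \<le> ereal t" "last_passage B l z \<omega> \<noteq> - \<infinity>"
  shows "stopped_process B l z t \<omega> = z"
proof -
  define S where "S = {t. 0 < t \<and> drifted B l t \<omega> = z}"
  have lp: "last_passage B l z \<omega> = (SUP x\<in>S. ereal x)" by (simp add: last_passage_def S_def)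
  \<comment> \<open>Time 0 may be added to the range because the path starts at 0, which differs
    from \<open>z\<close>; this makes the set closed.\<close>
  have "S = {t \<in> {0..}. drifted B l t \<omega> = z}"
    using assms(2) start_zero[OF assms(1)] by (auto simp: S_def drifted_def order_le_less)
  then have "closed S"
    using continuous_closed_preimage_constant[OF continuous_on_drifted[OF assms(1)]] by simp
  moreover have "S \<noteq> {}" using assms(4) by (auto simp: lp bot_ereal_def)
  moreover have "bdd_above S"
    using assms(3) by (auto simp: lp SUP_le_iff intro!: bdd_aboveI[of _ t])
  ultimately have "Sup S \<in> S" by (intro closed_contains_Sup)
  have "last_passage B l z \<omega> = ereal (Sup S)"
    using assms(3,4) unfolding lp by (intro ereal_Sup[symmetric]) (auto simp: lp)
  then show ?thesis
    using assms(3) \<open>Sup S \<in> S\<close> by (simp add: stopped_process_def min_absorb2 S_def)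
qed

text \<open>The stopping time \<open>-\<infinity>\<close> is read as 0 by
  \<open>real_of_ereal\<close>, so the path is frozen at its start.\<close>

lemma stopped_process_unhit:
  "\<omega> \<in> space M \<Longrightarrow> last_passage B l z \<omega> = - \<infinity> \<Longrightarrow> stopped_process B l z t \<omega> = 0"
  by (simp add: stopped_process_def drifted_def start_zero)

lemma distributed_B:
  assumes "0 < s"
  shows "distributed M lborel (B s) (normal_density 0 (sqrt s))"
proof -
  have "distr M lborel (B s) = distr M lborel (\<lambda>\<omega>. B s \<omega> - B 0 \<omega>)"
    by (rule distr_cong) (auto simp: start_zero)
  then show ?thesis
    using gaussian_increments[of 0 s] assms measurable_B[of s] by (simp add: distributed_def)
qed

lemma prob_position_and_increment:
  assumes "0 < s" "0 < t" "I \<in> sets borel" "J \<in> sets borel"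
  shows "prob ((B s -` I \<inter> space M) \<inter> ((\<lambda>\<omega>. B (s + t) \<omega> - B s \<omega>) -` J \<inter> space M))
    = prob (B s -` I \<inter> space M) * prob ((\<lambda>\<omega>. B (s + t) \<omega> - B s \<omega>) -` J \<inter> space M)"
proof -
  \<comment> \<open>The times 0, \<open>s\<close>, \<open>s + t\<close>, constant from then on to
    keep \<open>r\<close> monotone; the first two increments are the position at \<open>s\<close>
    and the increment after it.\<close>
  define r where "r i = (if i = 0 then 0 else if i = 1 then s else s + t)" for i :: nat
  have "mono r" using assms by (auto simp: monotone_on_def r_def)
  have ind: "indep_vars (\<lambda>_. borel) (\<lambda>i \<omega>. B (r (Suc i)) \<omega> - B (r i) \<omega>) {..<2::nat}"
    by (rule indep_increments[OF \<open>mono r\<close>]) (simp add: r_def)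
  have eq: "(\<lambda>\<omega>. B s \<omega> - B 0 \<omega>) -` I \<inter> space M = B s -` I \<inter> space M"
    by (auto simp: start_zero)
  have "{..<2::nat} = {0, 1}" by auto
  then show ?thesis
    using indep_varsD_finite[OF ind, of "\<lambda>i. if i = 0 then I else J"] assms
    by (simp add: r_def eq)
qed

text \<open>The drifted path starts below \<open>z\<close> and tends to infinity, so almost surely
  it hits \<open>z\<close> and has left it for good by some integer time. If sitting at
  \<open>z\<close> had probability 0 at each integer time, countably many null events would cover
  almost every path. Measurability is assumed here because \<open>markov_with_semigroup\<close>
  supplies it.\<close>

lemma stopped_process_reaches_level:
  assumes "0 < l" "0 < z" and meas: "\<And>t. 0 \<le> t \<Longrightarrow> stopped_process B l z t \<in> borel_measurable M"
  obtains s where "0 < s" "0 < prob (stopped_process B l z s -` {z} \<inter> space M)"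
proof (rule ccontr)
  assume "\<not> thesis"
  with that have null: "prob (stopped_process B l z s -` {z} \<inter> space M) = 0" if "0 < s" for s
    using that by (metis measure_nonneg order_le_less)
  have "AE \<omega> in M. stopped_process B l z (real (Suc n)) \<omega> \<noteq> z" for n
    using null[of "real (Suc n)"] meas[of "real (Suc n)"]
    by (intro AE_I[of _ _ "stopped_process B l z (real (Suc n)) -` {z} \<inter> space M"])
      (auto simp: emeasure_eq_measure)
  then have "AE \<omega> in M. \<forall>n. stopped_process B l z (real (Suc n)) \<omega> \<noteq> z"
    by (simp only: AE_all_countable) simp
  moreover have "AE \<omega> in M. \<omega> \<in> space M" by (rule AE_space)
  ultimately have "AE \<omega> in M. False"
    using drifted_tendsto_infinity[OF \<open>0 < l\<close>]
  proof eventually_elim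
    fix \<omega>
    assume never: "\<forall>n. stopped_process B l z (real (Suc n)) \<omega> \<noteq> z" and \<omega>: "\<omega> \<in> space M"
      and "\<forall>c. \<exists>N::nat. \<forall>t\<ge>real N. c < drifted B l t \<omega>"
    then obtain N :: nat where N: "\<And>t. t \<ge> real N \<Longrightarrow> z < drifted B l t \<omega>" by blast
    have "drifted B l 0 \<omega> < z" using \<open>0 < z\<close> \<omega> by (simp add: drifted_def start_zero)
    then obtain t where "0 < t" "drifted B l t \<omega> = z"
      using drifted_hits[OF \<omega>, of 0 "real (Suc N)" l z] N[of "real (Suc N)"] by auto
    then have "last_passage B l z \<omega> \<noteq> - \<infinity>"
      using le_last_passage[of t l \<omega> z] by auto
    moreover have "last_passage B l z \<omega> \<le> ereal (real (Suc N))"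
      unfolding last_passage_def
    proof (rule Sup_least)
      fix x assume "x \<in> ereal ` {t. 0 < t \<and> drifted B l t \<omega> = z}"
      then obtain u where u: "x = ereal u" "drifted B l u \<omega> = z" by auto
      then have "u < real N" using N[of u] by (meson less_irrefl not_le)
      then show "x \<le> ereal (real (Suc N))" using u by simp
    qed
    ultimately have "stopped_process B l z (real (Suc N)) \<omega> = z"
      using \<omega> \<open>0 < z\<close> by (intro stopped_process_at_level) auto
    with never show False by blast
  qed
  then show False by simp
qed

section \<open>Arbitrary Markov semigroups of the stopped process\<close>

text \<open>The Markov property is tested only on events \<open>X s \<in> A\<close> for one time
  \<open>s\<close>, so the argument covers every semigroup of the process. The contradiction is
  \<open>prob U * prob D \<le> prob U * (prob D / 2)\<close> with both factors positive.\<close>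

lemma stopped_markov_not_preserves_C0:
  assumes "0 < l" "0 < z" and mk: "markov_with_semigroup M (stopped_process B l z) Q"
  shows "\<not> preserves_C0 Q"
proof
  assume pres: "preserves_C0 Q"
  define X where "X = stopped_process B l z"
  define g where "g = Q 1 (tent z)"
  have X_meas: "X t \<in> borel_measurable M" if "0 \<le> t" for t
    using mk that by (auto simp: markov_with_semigroup_def X_def)
  have "g \<in> C0" using pres tent_C0 by (auto simp: preserves_C0_def g_def)
  then have g_cont: "continuous_on UNIV g" by (simp add: C0_def)
  then have g_meas[measurable]: "g \<in> borel_measurable borel"
    by (rule borel_measurable_continuous_onI)
  have f_meas[measurable]: "tent z \<in> borel_measurable borel"
    using continuous_on_tent by (rule borel_measurable_continuous_onI)
  obtain s where "0 < s" and s: "0 < prob (X s -` {z} \<inter> space M)"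
    using stopped_process_reaches_level[OF \<open>0 < l\<close> \<open>0 < z\<close>] X_meas unfolding X_def by blast
  have [measurable]: "X s \<in> borel_measurable M" "X (s + 1) \<in> borel_measurable M"
    using \<open>0 < s\<close> by (auto intro!: X_meas)
  have [measurable]: "B s \<in> borel_measurable M" "B (s + 1) \<in> borel_measurable M"
    using \<open>0 < s\<close> by (auto intro!: measurable_B)
  define F where "F = natural_filtration M X s"
  have gen: "{X u -` A \<inter> space M |u A. 0 \<le> u \<and> u \<le> s \<and> A \<in> sets borel} \<subseteq> sets M"
    using X_meas by auto
  then have "subalgebra M F"
    unfolding subalgebra_def F_def natural_filtration_def
    by (simp add: space_measure_of_conv sets.sigma_sets_subset sets_measure_of_conv)
  then interpret F: finite_measure_subalgebra M F
    by unfold_locales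
  have X_in_F: "X s -` A \<inter> space M \<in> sets F" if "A \<in> sets borel" for A
  proof -
    have "{X u -` A \<inter> space M |u A. 0 \<le> u \<and> u \<le> s \<and> A \<in> sets borel} \<subseteq> Pow (space M)" by auto
    then show ?thesis
      using that \<open>0 < s\<close> unfolding F_def natural_filtration_def
      by (subst sets_measure_of) (auto intro!: sigma_sets.Basic exI[of _ s] exI[of _ A])
  qed
  have f_int: "integrable M (\<lambda>\<omega>. tent z (X (s + 1) \<omega>))"
    using tent_nonneg tent_le by (intro integrable_const_bound[where B = 3]) auto
  have mk_AE: "AE \<omega> in M. real_cond_exp M F (\<lambda>\<omega>. tent z (X (s + 1) \<omega>)) \<omega> = g (X s \<omega>)"
    using mk tent_bounded_borel[of z] \<open>0 < s\<close>
    by (simp add: markov_with_semigroup_def X_def F_def g_def)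
  \<comment> \<open>The Markov identity integrated over the event \<open>X s \<in> A\<close>, which
    belongs to the natural filtration at time \<open>s\<close>.\<close>
  have key: "(\<integral>\<omega>. indicator A (X s \<omega>) * tent z (X (s + 1) \<omega>) \<partial>M)
      = (\<integral>\<omega>. indicator A (X s \<omega>) * g (X s \<omega>) \<partial>M)" if A[measurable]: "A \<in> sets borel" for A
  proof -
    let ?A = "X s -` A \<inter> space M"
    have ind: "indicator ?A \<omega> = (indicator A (X s \<omega>) :: real)" if "\<omega> \<in> space M" for \<omega>
      using that by (auto simp: indicator_def)
    have "(\<integral>\<omega>. indicator A (X s \<omega>) * tent z (X (s + 1) \<omega>) \<partial>M)
        = (\<integral>\<omega>\<in>?A. tent z (X (s + 1) \<omega>) \<partial>M)"
      unfolding set_lebesgue_integral_def by (intro Bochner_Integration.integral_cong) (auto simp: ind)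
    also have "\<dots> = (\<integral>\<omega>\<in>?A. real_cond_exp M F (\<lambda>\<omega>. tent z (X (s + 1) \<omega>)) \<omega> \<partial>M)"
      using f_int X_in_F[OF A] by (rule F.real_cond_exp_intA)
    also have "\<dots> = (\<integral>\<omega>. indicator A (X s \<omega>) * g (X s \<omega>) \<partial>M)"
      unfolding set_lebesgue_integral_def
      using mk_AE AE_space
      by (intro integral_cong_AE borel_measurable_scaleR borel_measurable_indicator)
        (auto simp: ind elim!: eventually_elim2)
    finally show ?thesis .
  qed

  \<comment> \<open>Off this null event, \<open>X s = z\<close> can only mean that the last passage
    is already over.\<close>
  have not_at_level: "AE \<omega> in M. B s \<omega> \<noteq> z - l * s"
    using distributed_B[OF \<open>0 < s\<close>] by (rule distributed_AE_neq)

  have "g z = 0"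
  proof -
    have "AE \<omega> in M. indicator {z} (X s \<omega>) * tent z (X (s + 1) \<omega>) = 0"
      using not_at_level
    proof eventually_elim
      fix \<omega> assume ne: "B s \<omega> \<noteq> z - l * s"
      have "X (s + 1) \<omega> = z" if "X s \<omega> = z"
      proof -
        have "\<not> ereal s \<le> last_passage B l z \<omega>"
          using ne that stopped_process_before[of s l z \<omega>] by (auto simp: X_def drifted_def)
        then show ?thesis
          using that stopped_process_after[of l z \<omega> s "s + 1"] by (simp add: X_def)
      qed
      then show "indicator {z} (X s \<omega>) * tent z (X (s + 1) \<omega>) = 0"
        by (auto simp: indicator_def)
    qed
    then have "(\<integral>\<omega>. indicator {z} (X s \<omega>) * tent z (X (s + 1) \<omega>) \<partial>M) = 0"
      by (intro integral_eq_zero_AE)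
    then have "0 = (\<integral>\<omega>. indicator {z} (X s \<omega>) * g (X s \<omega>) \<partial>M)"
      using key[of "{z}"] by simp
    also have "\<dots> = (\<integral>\<omega>. g z * indicator (X s -` {z} \<inter> space M) \<omega> \<partial>M)"
      by (intro Bochner_Integration.integral_cong) (auto simp: indicator_def)
    also have "\<dots> = g z * prob (X s -` {z} \<inter> space M)"
      by simp
    finally show ?thesis using s by simp
  qed

  \<comment> \<open>Over a unit of time the drift adds \<open>l\<close>, so on \<open>D\<close> the
    drifted path moves by an amount in \<open>(-2, -1)\<close>.\<close>
  define D where "D = (\<lambda>\<omega>. B (s + 1) \<omega> - B s \<omega>) -` {- 2 - l<..<- 1 - l} \<inter> space M"
  have D_pos: "0 < prob D"
    unfolding D_def using \<open>0 < s\<close>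
    by (intro distributed_open_interval_pos[OF prob_space_axioms gaussian_increments[of s "s + 1"]])
      (auto intro!: normal_density_pos)
  obtain d0 where "0 < d0" and d0: "\<And>x. \<bar>x - z\<bar> < d0 \<Longrightarrow> \<bar>g x\<bar> < prob D / 2"
    using g_cont \<open>g z = 0\<close> D_pos unfolding continuous_on_iff dist_real_def
    by (metis UNIV_I diff_zero half_gt_zero)
  define d where "d = Min {d0, 1 / 2, z}"
  have d: "0 < d" "d \<le> d0" "d \<le> 1 / 2" "d \<le> z"
    using \<open>0 < d0\<close> \<open>0 < z\<close> by (auto simp: d_def)
  define U where "U = B s -` {z - l * s - d<..<z - l * s + d} \<inter> space M"
  have U_iff: "\<omega> \<in> U \<longleftrightarrow> \<omega> \<in> space M \<and> \<bar>drifted B l s \<omega> - z\<bar> < d" for \<omega>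
    by (auto simp: U_def drifted_def abs_less_iff)
  have [measurable]: "U \<in> sets M" "D \<in> sets M"
    unfolding U_def D_def by measurable
  have U_pos: "0 < prob U"
    unfolding U_def using \<open>0 < s\<close> \<open>0 < d\<close>
    by (intro distributed_open_interval_pos[OF prob_space_axioms distributed_B[OF \<open>0 < s\<close>]])
      (auto intro!: normal_density_pos)

  define A where "A = {z - d<..<z + d} - {z}"
  have [measurable]: "A \<in> sets borel" by (simp add: A_def)
  have "prob U * prob D = prob (U \<inter> D)"
    unfolding U_def D_def using \<open>0 < s\<close> by (intro prob_position_and_increment[symmetric]) auto
  also have "\<dots> = (\<integral>\<omega>. indicator (U \<inter> D) \<omega> \<partial>M)"
    by simp
  \<comment> \<open>On \<open>U\<close> and \<open>D\<close> the path is below \<open>z\<close> at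
    \<open>s + 1\<close> and must hit \<open>z\<close> later, so at both times the stopped process
    still agrees with the drifted one.\<close>
  also have "\<dots> \<le> (\<integral>\<omega>. indicator A (X s \<omega>) * tent z (X (s + 1) \<omega>) \<partial>M)"
  proof (rule integral_mono_AE)
    show "integrable M (\<lambda>\<omega>. indicator A (X s \<omega>) * tent z (X (s + 1) \<omega>))"
      using tent_nonneg tent_le
      by (intro integrable_const_bound[where B = 3]) (auto split: split_indicator)
    show "AE \<omega> in M. indicator (U \<inter> D) \<omega> \<le> indicator A (X s \<omega>) * tent z (X (s + 1) \<omega>)"
      using not_at_level drifted_tendsto_infinity[OF \<open>0 < l\<close>]
    proof eventually_elim
      fix \<omega> assume ne: "B s \<omega> \<noteq> z - l * s"
        and inf: "\<forall>c. \<exists>N::nat. \<forall>t\<ge>real N. c < drifted B l t \<omega>"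
      show "indicator (U \<inter> D) \<omega> \<le> indicator A (X s \<omega>) * tent z (X (s + 1) \<omega>)"
      proof (cases "\<omega> \<in> U \<inter> D")
        case True
        then have \<omega>: "\<omega> \<in> space M" and near: "\<bar>drifted B l s \<omega> - z\<bar> < d" by (auto simp: U_iff)
        have "drifted B l (s + 1) \<omega> - drifted B l s \<omega> \<in> {- 2<..<- 1}"
          using True by (auto simp: D_def drifted_def algebra_simps)
        with near d have range: "drifted B l (s + 1) \<omega> \<in> {z - 5 / 2<..<z - 1 / 2}" by auto
        obtain N :: nat where N: "\<And>t. t \<ge> real N \<Longrightarrow> z < drifted B l t \<omega>" using inf by blast
        define T where "T = max (s + 1) (real N)"
        have "s + 1 \<le> T" "z < drifted B l T \<omega>" using N[of T] by (auto simp: T_def)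
        then obtain t where "s + 1 < t" "drifted B l t \<omega> = z"
          using drifted_hits[OF \<omega>, of "s + 1" T l z] range \<open>0 < s\<close> by auto
        then have "ereal t \<le> last_passage B l z \<omega>"
          using \<open>0 < s\<close> by (intro le_last_passage) auto
        moreover have "ereal s \<le> ereal t" "ereal (s + 1) \<le> ereal t" using \<open>s + 1 < t\<close> by auto
        ultimately have "ereal s \<le> last_passage B l z \<omega>" "ereal (s + 1) \<le> last_passage B l z \<omega>"
          by (blast intro: order_trans)+
        then have "X (s + 1) \<omega> = drifted B l (s + 1) \<omega>" "X s \<omega> = drifted B l s \<omega>"
          by (simp_all only: X_def stopped_process_before)
        moreover have "drifted B l s \<omega> \<noteq> z" using ne by (auto simp: drifted_def)
        ultimately have "X s \<omega> \<in> A" "1 \<le> tent z (X (s + 1) \<omega>)"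
          using near range by (auto simp: A_def abs_less_iff intro!: tent_ge_1)
        then show ?thesis by (simp add: indicator_def)
      qed (simp add: tent_nonneg)
    qed
  qed (intro integrable_const_bound[where B = 1], auto)
  also have "\<dots> = (\<integral>\<omega>. indicator A (X s \<omega>) * g (X s \<omega>) \<partial>M)"
    by (intro key) measurable
  \<comment> \<open>Once stopped, the process is at \<open>z\<close> or at 0, and \<open>A\<close>
    contains neither. So \<open>X s \<in> A\<close> forces the drifted path itself to be near
    \<open>z\<close>, that is, the event \<open>U\<close>.\<close>
  also have "\<dots> \<le> (\<integral>\<omega>. prob D / 2 * indicator U \<omega> \<partial>M)"
  proof (rule integral_mono)
    have small: "\<bar>g x\<bar> < prob D / 2" if "x \<in> A" for x
      using that d by (intro d0) (auto simp: A_def)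
    then show "integrable M (\<lambda>\<omega>. indicator A (X s \<omega>) * g (X s \<omega>))"
      using D_pos
      by (intro integrable_const_bound[where B = "prob D / 2"])
        (auto split: split_indicator intro: less_imp_le)
    fix \<omega> assume \<omega>: "\<omega> \<in> space M"
    have "\<omega> \<in> U" if "X s \<omega> \<in> A"
    proof -
      have "ereal s \<le> last_passage B l z \<omega>"
      proof (rule ccontr)
        assume "\<not> ereal s \<le> last_passage B l z \<omega>"
        then have "X s \<omega> = z \<or> X s \<omega> = 0"
          using stopped_process_at_level[OF \<omega>, of z l s] stopped_process_unhit[OF \<omega>, of l z s] \<open>0 < z\<close>
          by (cases "last_passage B l z \<omega> = - \<infinity>") (auto simp: X_def)
        with that d show False by (auto simp: A_def)
      qed
      then have "X s \<omega> = drifted B l s \<omega>" unfolding X_def by (rule stopped_process_before)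
      with that \<omega> show ?thesis by (auto simp: U_iff A_def abs_less_iff)
    qed
    then show "indicator A (X s \<omega>) * g (X s \<omega>) \<le> prob D / 2 * indicator U \<omega>"
      using small[of "X s \<omega>"] D_pos by (auto simp: indicator_def)
  qed (intro integrable_mult_right integrable_const_bound[where B = 1], auto)
  also have "\<dots> = prob U * (prob D / 2)"
    by simp
  finally show False using U_pos D_pos by simp
qed

end

theorem mainTheorem2:
  fixes M :: "'a measure" and B :: "real \<Rightarrow> 'a \<Rightarrow> real" and l z :: real
  assumes "standard_brownian_motion M B"
    and "l > 0" and "z > 0"
  shows "\<not> feller_process M (stopped_process B l z)
    \<and> (\<forall>Q. markov_with_semigroup M (stopped_process B l z) Q \<longrightarrow> \<not> preserves_C0 Q)
    \<and> \<not> preserves_C0 (stopped_semigroup l z)"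
proof -
  interpret standard_brownian_motion M B by fact
  \<comment> \<open>The Feller claim follows from the second conjunct, as a Feller process would
    supply a semigroup preserving \<open>C0\<close>.\<close>
  show ?thesis
    using stopped_markov_not_preserves_C0[OF assms(2,3)] stopped_semigroup_not_C0[OF assms(2)]
    unfolding feller_process_def by blast
qed

end
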